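(* Let $n\ge 1$ be an integer, and consider the $2^{n+2}$ assignments of over/under data to the crossings of the free $2\ n$ knot. If $n$ is odd, exactly $2^{n+1}+2\binom{n}{\frac{n-1}{2}}$ of the assignments produce the unknot and exactly $2\binom{n}{\frac{n-1}{2}}$ produce the trefoil. If $n$ is even, exactly $2^{n+1}+2\binom{n}{\frac{n}{2}}$ of the assignments produce the unknot.
   Context: The free $2\ n$ knot is the following planar closed curve with $n+2$ double points (the free closure of Conway's $2\ n$ tangle). Take a horizontal row of $n$ crossings: two parallel horizontal strands crossing each other $n$ times in succession, with four ends (upper-left, lower-left, upper-right, lower-right). Above it place a vertical column of $2$ crossings: two parallel vertical strands crossing each other twice in succession, with four ends (upper-left, upper-right, lower-left, lower-right). Join the lower-left end of the column to the upper-left end of the row, the lower-right end of the column to the upper-right end of the row, the upper-left end of the column to the lower-left end of the row (by an arc around the left side), and the upper-right end of the column to the lower-right end of the row (by an arc around the right side), without creating further crossings. An assignment is a choice, at each crossing, of which of the two strands is the overstrand; it produces a knot diagram. Knots are not distinguished from their mirror images. *)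

theory Defs
  imports Main "HOL-Library.FuncSet"
begin

text \<open>
  Diagrams in the plane are put in general position with respect to the height function and
  recorded as words of elementary slices, read from top to bottom. The strands meeting a
  horizontal line between two slices are numbered \<open>0, 1, 2, \<dots>\<close> from left to right.

  \<^item> \<open>Cap i\<close> is a local maximum: it creates two strands, at positions \<open>i\<close> and \<open>i + 1\<close>.
  \<^item> \<open>Cup i\<close> is a local minimum: it joins the strands at positions \<open>i\<close> and \<open>i + 1\<close>.
  \<^item> \<open>Cross c i\<close> is a double point of the strands at positions \<open>i\<close> and \<open>i + 1\<close>, with label \<open>c\<close>.

  Words over \<^typ>\<open>nat\<close> describe plane curves whose double points carry names. In words
  over \<^typ>\<open>bool\<close> the label is the crossing information: \<open>True\<close> means that the strand running
  from upper left to lower right is the overstrand, \<open>False\<close> that the other one is.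
\<close>

datatype 'c slice = Cap nat | Cup nat | Cross 'c nat

primrec pos :: "'c slice \<Rightarrow> nat" where
  "pos (Cap i) = i"
| "pos (Cup i) = i"
| "pos (Cross c i) = i"

primrec ins :: "'c slice \<Rightarrow> nat" where
  "ins (Cap i) = 0"
| "ins (Cup i) = 2"
| "ins (Cross c i) = 2"

primrec outs :: "'c slice \<Rightarrow> nat" where
  "outs (Cap i) = 2"
| "outs (Cup i) = 0"
| "outs (Cross c i) = 2"

primrec shift :: "nat \<Rightarrow> 'c slice \<Rightarrow> 'c slice" where
  "shift k (Cap i) = Cap (i + k)"
| "shift k (Cup i) = Cup (i + k)"
| "shift k (Cross c i) = Cross c (i + k)"

text \<open>\<open>tangle m D k\<close>: the word \<open>D\<close> fits together, with \<open>m\<close> strands at the top and \<open>k\<close> at the bottom.\<close>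

primrec tangle :: "nat \<Rightarrow> 'c slice list \<Rightarrow> nat \<Rightarrow> bool" where
  "tangle m [] k \<longleftrightarrow> m = k"
| "tangle m (s # D) k \<longleftrightarrow> pos s + ins s \<le> m \<and> tangle (m - ins s + outs s) D k"

definition closed_diagram :: "'c slice list \<Rightarrow> bool" where
  "closed_diagram D \<longleftrightarrow> tangle 0 D 0"

text \<open>
  Local moves. The first three groups (\<open>interchange\<close>, \<open>zigzag\<close>, \<open>slide\<close>) are the generators of
  planar isotopy for sliced diagrams: two slices side by side exchange their heights, a
  maximum cancels against an adjacent minimum, and a strand crossing one leg of a maximum or
  minimum is moved to the other leg. The remaining ones are the Reidemeister moves. In
  \<open>R3\<close>, with the strands \<open>x, y, z\<close> from left to right at the top, \<open>a\<close>, \<open>b\<close>, \<open>c\<close> say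
  whether \<open>x\<close> is over \<open>y\<close>, \<open>x\<close> over \<open>z\<close>, \<open>y\<close> over \<open>z\<close>; the side condition excludes exactly
  the two cyclic patterns, in which the strands do not lie in three different layers.
\<close>

inductive move :: "bool slice list \<Rightarrow> bool slice list \<Rightarrow> bool" where
  interchange: "pos s \<le> pos t \<Longrightarrow> move [s, shift (outs s) t] [shift (ins s) t, s]"
| zigzag_left: "move [Cap i, Cup (i + 1)] []"
| zigzag_right: "move [Cap (i + 1), Cup i] []"
| slide_cap: "move [Cap (i + 1), Cross c i] [Cap i, Cross (\<not> c) (i + 1)]"
| slide_cup: "move [Cross c i, Cup (i + 1)] [Cross (\<not> c) (i + 1), Cup i]"
| R1_cap: "move [Cap i, Cross c i] [Cap i]"
| R1_cup: "move [Cross c i, Cup i] [Cup i]"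
| R2: "move [Cross c i, Cross (\<not> c) i] []"
| R3: "b = a \<or> b = c \<Longrightarrow>
    move [Cross a i, Cross b (i + 1), Cross c i]
         [Cross c (i + 1), Cross b i, Cross a (i + 1)]"

text \<open>
  Some instances of the moves fit only if enough strands are present (\<open>zigzag_left\<close> read from
  right to left, say), so both sides of a step are required to be closed diagrams.
\<close>

definition move_step :: "bool slice list \<Rightarrow> bool slice list \<Rightarrow> bool" where
  "move_step D D' \<longleftrightarrow> closed_diagram D \<and> closed_diagram D' \<and>
     (\<exists>u v a b. move a b \<and> D = u @ a @ v \<and> D' = u @ b @ v)"

definition isotopic :: "bool slice list \<Rightarrow> bool slice list \<Rightarrow> bool" where
  "isotopic = equivclp move_step"

definition mirror :: "bool slice list \<Rightarrow> bool slice list" where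
  "mirror D = map (map_slice Not) D"

text \<open>Knots are not distinguished from their mirror images.\<close>

definition same_knot :: "bool slice list \<Rightarrow> bool slice list \<Rightarrow> bool" where
  "same_knot D D' \<longleftrightarrow> isotopic D D' \<or> isotopic D (mirror D')"

definition unknot :: "bool slice list" where
  "unknot = [Cap 0, Cup 0]"

text \<open>Three equal half twists of two vertical strands, closed up by an arc on either side.\<close>

definition trefoil :: "bool slice list" where
  "trefoil = [Cap 0, Cap 2, Cross True 1, Cross True 1, Cross True 1, Cup 0, Cup 0]"

text \<open>
  The free \<open>2 n\<close> knot, for \<open>n \<ge> 1\<close>. Double points \<open>0\<close> and \<open>1\<close> form the column, \<open>2, \<dots>, n + 1\<close>
  the row. The outermost strands are the arcs around the left and right side. Neighbouring
  crossings of the row, drawn at strand positions \<open>(1, 2), (3, 4), \<dots>, (2 n - 1, 2 n)\<close>, have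
  their facing upper ends joined by a maximum and their facing lower ends by a minimum.
\<close>

definition free_knot :: "nat \<Rightarrow> nat slice list" where
  "free_knot n =
     [Cap 0, Cap 2] @
     [Cross 0 1, Cross 1 1] @
     map (\<lambda>j. Cap (2 * j + 2)) [0..<n - 1] @
     map (\<lambda>j. Cross (j + 2) (2 * j + 1)) [0..<n] @
     replicate (n - 1) (Cup 2) @
     [Cup 0, Cup 0]"

definition assignments :: "nat \<Rightarrow> (nat \<Rightarrow> bool) set" where
  "assignments n = {..<n + 2} \<rightarrow>\<^sub>E UNIV"

definition assigned_diagram :: "nat \<Rightarrow> (nat \<Rightarrow> bool) \<Rightarrow> bool slice list" where
  "assigned_diagram n \<omega> = map (map_slice \<omega>) (free_knot n)"

lemma card_assignments: "card (assignments n) = 2 ^ (n + 2)"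
  by (simp add: assignments_def card_PiE)

lemma tangle_append: "tangle m (D @ E) k \<longleftrightarrow> (\<exists>l. tangle m D l \<and> tangle l E k)"
  by (induction D arbitrary: m) auto

lemma tangle_appendI: "tangle m D l \<Longrightarrow> tangle l E k \<Longrightarrow> tangle m (D @ E) k"
  by (auto simp: tangle_append)

lemma tangle_caps: "tangle 4 (map (\<lambda>j. Cap (2 * j + 2)) [0..<p]) (4 + 2 * p)"
  by (induction p) (auto simp: tangle_append)

lemma tangle_row: "2 * p + 1 \<le> m \<Longrightarrow> tangle m (map (\<lambda>j. Cross (f j) (2 * j + 1)) [0..<p]) m"
  by (induction p) (auto simp: tangle_append)

lemma tangle_cups: "tangle (4 + 2 * p) (replicate p (Cup 2)) 4"
  by (induction p) auto

lemma closed_assigned_diagram: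
  assumes "n \<ge> 1"
  shows "closed_diagram (assigned_diagram n \<omega>)"
proof -
  obtain p where n: "n = Suc p"
    using assms by (cases n) auto
  have row: "tangle (4 + 2 * p) (map (\<lambda>j. Cross (\<omega> (j + 2)) (2 * j + 1)) [0..<n]) (4 + 2 * p)"
    unfolding n by (rule tangle_row) simp
  have top: "tangle 0 [Cap 0, Cap 2, Cross (\<omega> 0) 1, Cross (\<omega> 1) 1] 4"
    and bot: "tangle 4 [Cup 0, Cup 0] 0" by simp_all
  have "assigned_diagram n \<omega> =
      [Cap 0, Cap 2, Cross (\<omega> 0) 1, Cross (\<omega> 1) 1] @ map (\<lambda>j. Cap (2 * j + 2)) [0..<p] @
      map (\<lambda>j. Cross (\<omega> (j + 2)) (2 * j + 1)) [0..<n] @ replicate p (Cup 2) @ [Cup 0, Cup 0]"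
    by (simp add: assigned_diagram_def free_knot_def n comp_def del: upt_Suc)
  then show ?thesis
    unfolding closed_diagram_def
    using tangle_appendI[OF top tangle_appendI[OF tangle_caps tangle_appendI[OF row
            tangle_appendI[OF tangle_cups bot]]]]
    by (simp only:)
qed

end

theory Submission imports Defs begin

text \<open>
  If the two crossings of the column carry different labels, they cancel and only curls are left.
  Otherwise they form a clasp. A quarter turn, which flips the labels, makes the row a column in
  which neighbours with different labels cancel, so that only the signed number \<open>t\<close> of its
  crossings, relative to the clasp, matters: \<open>t = 0\<close> and \<open>t = 1\<close> give the unknot, \<open>t = -1\<close> the
  trefoil. Fox colourings exclude the other values of \<open>t\<close> of the relevant parity: with
  \<open>m = \<bar>1 - 2 t\<bar>\<close>, the determinant, the diagram has \<open>m\<^sup>2\<close> colourings modulo \<open>m\<close>, the unknot has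
  \<open>m\<close>, and the trefoil has \<open>m\<^sup>2\<close> only if \<open>m\<close> divides \<open>3\<close>.
\<close>

section \<open>Invariance of the number of Fox colourings\<close>

text \<open>This is Fox's rule: the overstrand keeps its colour, the understrand leaves with its
  colour reflected in that of the overstrand. No orientation of the strands enters.\<close>

primrec cross_colors :: "bool \<Rightarrow> nat \<Rightarrow> (nat \<Rightarrow> int) \<Rightarrow> nat \<Rightarrow> int" where
  "cross_colors True i f = f(i := 2 * f i - f (Suc i), Suc i := f i)"
| "cross_colors False i f = f(i := f (Suc i), Suc i := 2 * f (Suc i) - f i)"

definition cap_colors :: "nat \<Rightarrow> int \<Rightarrow> (nat \<Rightarrow> int) \<Rightarrow> nat \<Rightarrow> int" where
  "cap_colors i x f = (\<lambda>j. if j < i then f j else if j < i + 2 then x else f (j - 2))"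

definition cup_colors :: "nat \<Rightarrow> (nat \<Rightarrow> int) \<Rightarrow> nat \<Rightarrow> int" where
  "cup_colors i f = (\<lambda>j. if j < i then f j else f (j + 2))"

text \<open>
  The number of Fox \<open>m\<close>-colourings with prescribed colours \<open>f\<close> of the strands at the top. A state
  assigns colours to infinitely many strands, of which a closed diagram leaves all but finitely
  many alone; so the invariance under moves does not depend on the number of strands.
\<close>

primrec colorings :: "int \<Rightarrow> bool slice list \<Rightarrow> (nat \<Rightarrow> int) \<Rightarrow> nat" where
  "colorings m [] f = 1"
| "colorings m (s # D) f =
    (case s of
       Cap i \<Rightarrow> (\<Sum>x\<in>{0..<m}. colorings m D (cap_colors i x f))
     | Cup i \<Rightarrow> if m dvd f i - f (Suc i) then colorings m D (cup_colors i f) else 0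
     | Cross b i \<Rightarrow> colorings m D (cross_colors b i f))"

text \<open>States hold integers rather than residues, and some moves reproduce a state only up to
  multiples of \<open>m\<close>. This does no harm: crossings act linearly with integer
  coefficients, and minima test divisibility by \<open>m\<close>.\<close>

lemma colorings_cong:
  assumes "\<And>j. m dvd f j - g j"
  shows "colorings m D f = colorings m D g"
  using assms
proof (induction D arbitrary: f g)
  case (Cons s D)
  show ?case
  proof (cases s)
    case (Cap i)
    have "colorings m D (cap_colors i x f) = colorings m D (cap_colors i x g)" for x
      by (rule Cons.IH) (simp add: cap_colors_def Cons.prems)
    then show ?thesis by (simp add: Cap)
  next
    case (Cup i)
    have "colorings m D (cup_colors i f) = colorings m D (cup_colors i g)"
      by (rule Cons.IH) (simp add: cup_colors_def Cons.prems)
    moreover have "m dvd f i - f (Suc i) \<longleftrightarrow> m dvd g i - g (Suc i)"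
      using Cons.prems[of i] Cons.prems[of "Suc i"] by (simp flip: mod_eq_dvd_iff)
    ultimately show ?thesis by (simp add: Cup)
  next
    case (Cross b i)
    have *: "m dvd 2 * f i - f j - (2 * g i - g j)" for i j
    proof -
      have "m dvd 2 * (f i - g i) - (f j - g j)"
        by (intro dvd_diff dvd_mult Cons.prems)
      then show ?thesis by (simp add: algebra_simps)
    qed
    have "colorings m D (cross_colors b i f) = colorings m D (cross_colors b i g)"
      by (rule Cons.IH) (cases b; simp add: Cons.prems *)
    then show ?thesis by (simp add: Cross)
  qed
qed simp

lemma colorings_append_cong:
  assumes "colorings m D = colorings m E"
  shows "colorings m (u @ D) = colorings m (u @ E)"
proof (induction u)
  case (Cons s u)
  show ?case by (rule ext) (simp add: Cons split: slice.split)
qed (simp add: assms)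

text \<open>Meant for the zigzags: the minimum forces the colour of the new maximum modulo
  \<open>m\<close>, and exactly one of the values \<open>0, ..., m - 1\<close> qualifies.\<close>

lemma sum_dvd_delta:
  fixes m y :: int
  assumes "m > 0" and "\<And>x. m dvd x - y \<Longrightarrow> g x = (a :: nat)"
  shows "(\<Sum>x\<in>{0..<m}. if m dvd x - y then g x else 0) = a"
proof -
  have "m dvd x - y \<longleftrightarrow> x = y mod m" if "x \<in> {0..<m}" for x
    using that by (simp flip: mod_eq_dvd_iff)
  then have "(\<Sum>x\<in>{0..<m}. if m dvd x - y then g x else 0)
      = (\<Sum>x\<in>{0..<m}. if x = y mod m then g x else 0)"
    by (intro sum.cong) auto
  also have "\<dots> = g (y mod m)"
    using assms(1) by (simp add: sum.delta)
  also have "\<dots> = a"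
    by (rule assms(2)) (simp flip: mod_eq_dvd_iff)
  finally show ?thesis .
qed

text \<open>Meant for \<open>slide_cap\<close>, where the colours of the maximum before and after
  the move can be reflections of each other; a reflection permutes the residues modulo
  \<open>m\<close>.\<close>

lemma sum_reflect_mod:
  fixes m y :: int
  assumes "m > 0" and "\<And>u v. m dvd u - v \<Longrightarrow> g u = g v"
  shows "(\<Sum>x\<in>{0..<m}. g (y - x)) = (\<Sum>x\<in>{0..<m}. g x :: nat)"
proof (rule sum.reindex_bij_witness[of _ "\<lambda>x. (y - x) mod m" "\<lambda>x. (y - x) mod m"])
  fix x assume "x \<in> {0..<m}"
  then show "(y - (y - x) mod m) mod m = x" "(y - (y - x) mod m) mod m = x"
    by (simp_all add: mod_diff_right_eq)
  show "(y - x) mod m \<in> {0..<m}" "(y - x) mod m \<in> {0..<m}"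
    using assms(1) by simp_all
  show "g ((y - x) mod m) = g (y - x)"
    by (rule assms(2)) (simp flip: mod_eq_dvd_iff)
qed

lemmas color_defs = cap_colors_def cup_colors_def

text \<open>The two slices touch disjoint sets of strands, so their effects on a state commute; the
  cases only keep track of the shifts in position. For two maxima the two summations change
  places.\<close>

lemma colorings_interchange:
  assumes "pos s \<le> pos t"
  shows "colorings m (s # shift (outs s) t # v) f = colorings m (shift (ins s) t # s # v) f"
proof (cases s)
  case s: (Cap i)
  show ?thesis
  proof (cases t)
    case (Cap j)
    have "cap_colors (j + 2) y (cap_colors i x f) = cap_colors i x (cap_colors j y f)" for x y
      using assms s Cap by (auto simp: color_defs fun_eq_iff)
    then show ?thesis
      using s Cap by simp (rule sum.swap)
  next
    case (Cup j)
    have "cup_colors (j + 2) (cap_colors i x f) = cap_colors i x (cup_colors j f)" for x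
      using assms s Cup by (auto simp: color_defs fun_eq_iff intro!: arg_cong[of _ _ f])
    moreover have "cap_colors i x f (j + 2) = f j" "cap_colors i x f (Suc (j + 2)) = f (Suc j)" for x
      using assms s Cup by (auto simp: color_defs)
    ultimately show ?thesis
      using s Cup by simp
  next
    case (Cross b j)
    have "cross_colors b (j + 2) (cap_colors i x f) = cap_colors i x (cross_colors b j f)" for x
      using assms s Cross by (cases b) (auto simp: color_defs fun_eq_iff)
    then show ?thesis
      using s Cross by simp
  qed
next
  case s: (Cup i)
  show ?thesis
  proof (cases t)
    case (Cap j)
    have "cap_colors j y (cup_colors i f) = cup_colors i (cap_colors (j + 2) y f)" for y
      using assms s Cap by (auto simp: color_defs fun_eq_iff intro!: arg_cong[of _ _ f])
    moreover have "cap_colors (j + 2) x f i = f i" "cap_colors (j + 2) x f (Suc i) = f (Suc i)" for x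
      using assms s Cap by (auto simp: color_defs)
    ultimately show ?thesis
      using s Cap by simp
  next
    case (Cup j)
    have "cup_colors j (cup_colors i f) = cup_colors i (cup_colors (j + 2) f)"
      using assms s Cup by (auto simp: color_defs fun_eq_iff)
    moreover have "cup_colors i f j = f (j + 2)" "cup_colors i f (Suc j) = f (Suc (j + 2))"
        "cup_colors (j + 2) f i = f i" "cup_colors (j + 2) f (Suc i) = f (Suc i)"
      using assms s Cup by (auto simp: color_defs)
    ultimately show ?thesis
      using s Cup by simp
  next
    case (Cross b j)
    have "cross_colors b j (cup_colors i f) = cup_colors i (cross_colors b (j + 2) f)"
      using assms s Cross by (cases b) (auto simp: color_defs fun_eq_iff)
    moreover have "cross_colors b (j + 2) f i = f i" "cross_colors b (j + 2) f (Suc i) = f (Suc i)"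
      using assms s Cross by (cases b; auto)+
    ultimately show ?thesis
      using s Cross by simp
  qed
next
  case s: (Cross c i)
  show ?thesis
  proof (cases t)
    case (Cap j)
    have "cap_colors (j + 2) y (cross_colors c i f) = cross_colors c i (cap_colors (j + 2) y f)" for y
      using assms s Cap by (cases c) (auto simp: color_defs fun_eq_iff)
    then show ?thesis
      using s Cap by simp
  next
    case (Cup j)
    have "cup_colors (j + 2) (cross_colors c i f) = cross_colors c i (cup_colors (j + 2) f)"
      using assms s Cup by (cases c) (auto simp: color_defs fun_eq_iff)
    moreover have "cross_colors c i f (j + 2) = f (j + 2)"
        "cross_colors c i f (Suc (j + 2)) = f (Suc (j + 2))"
      using assms s Cup by (cases c; auto)+
    ultimately show ?thesis
      using s Cup by simp
  next
    case (Cross b j)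
    have "cross_colors b (j + 2) (cross_colors c i f) = cross_colors c i (cross_colors b (j + 2) f)"
      using assms s Cross by (cases b; cases c) (auto simp: fun_eq_iff)
    then show ?thesis
      using s Cross by simp
  qed
qed

lemma colorings_move:
  assumes "m > 0" and "move a b"
  shows "colorings m (a @ v) f = colorings m (b @ v) f"
  using assms(2)
proof cases
  case (interchange s t)
  then show ?thesis by (simp add: colorings_interchange del: colorings.simps)
next
  case (zigzag_left i)
  have "colorings m v (cup_colors (Suc i) (cap_colors i x f)) = colorings m v f"
    if "m dvd x - f i" for x
    by (rule colorings_cong) (use that in \<open>auto simp: color_defs less_Suc_eq\<close>)
  then show ?thesis
    using zigzag_left sum_dvd_delta[OF assms(1), of "f i"] by (simp add: cap_colors_def[of i _ f])
next
  case (zigzag_right i)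
  have "colorings m v (cup_colors i (cap_colors (Suc i) x f)) = colorings m v f"
    if "m dvd x - f i" for x
    by (rule colorings_cong) (use that in \<open>auto simp: color_defs less_Suc_eq not_less_eq\<close>)
  then show ?thesis
    using zigzag_right sum_dvd_delta[OF assms(1), of "f i"]
    by (simp add: cap_colors_def[of "Suc i" _ f] dvd_diff_commute)
next
  case (slide_cap i c)
  show ?thesis
  proof (cases c)
    case True
    \<comment> \<open>For \<open>c = True\<close> the arc of the maximum passes under the strand of
      colour \<open>f i\<close>: its colour \<open>x\<close> before the move matches
      \<open>2 * f i - x\<close> after it.\<close>
    let ?g = "\<lambda>x. colorings m v (cross_colors False (Suc i) (cap_colors i x f))"
    have "colorings m v (cross_colors True i (cap_colors (Suc i) x f)) = ?g (2 * f i - x)" for x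
      by (rule arg_cong[of _ _ "colorings m v"]) (auto simp: color_defs fun_eq_iff)
    moreover have "?g x = ?g y" if "m dvd x - y" for x y
      by (rule colorings_cong)
        (use that dvd_mult[OF that, of 2] dvd_diff_commute[of m x y] in
          \<open>auto simp: color_defs algebra_simps\<close>)
    ultimately show ?thesis
      using slide_cap True sum_reflect_mod[OF assms(1), of ?g "2 * f i"] by simp
  next
    case False
    have "cross_colors False i (cap_colors (Suc i) x f) = cross_colors True (Suc i) (cap_colors i x f)" for x
      by (auto simp: color_defs fun_eq_iff)
    then show ?thesis using slide_cap False by simp
  qed
next
  case (slide_cup c i)
  let ?a = "cross_colors c i f" and ?b = "cross_colors (\<not> c) (Suc i) f"
  have "m dvd ?a (Suc i) - ?a (Suc (Suc i)) \<longleftrightarrow> m dvd ?b i - ?b (Suc i)"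
    using dvd_diff_commute[of m "2 * f (Suc i)" "f i + f (Suc (Suc i))"]
    by (cases c) (simp_all add: algebra_simps)
  moreover have "colorings m v (cup_colors (Suc i) ?a) = colorings m v (cup_colors i ?b)"
    if "m dvd ?a (Suc i) - ?a (Suc (Suc i))"
  proof (rule colorings_cong)
    fix j
    \<comment> \<open>For \<open>c = True\<close> the outgoing colours are
      \<open>2 * f i - f (i + 1)\<close> and \<open>2 * f (i + 2) - f (i + 1)\<close>; the condition
      at the minimum makes them congruent.\<close>
    have "m dvd 2 * f i - 2 * f (Suc (Suc i))" if "m dvd f i - f (Suc (Suc i))"
      using dvd_mult[OF that, of 2] by (simp add: algebra_simps)
    then show "m dvd cup_colors (Suc i) ?a j - cup_colors i ?b j"
      using that by (cases c) (auto simp: color_defs less_Suc_eq)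
  qed
  ultimately show ?thesis using slide_cup by simp
next
  case (R1_cap i c)
  have "cross_colors c i (cap_colors i x f) = cap_colors i x f" for x
    by (cases c) (auto simp: color_defs fun_eq_iff)
  then show ?thesis using R1_cap by simp
next
  case (R1_cup c i)
  have "cup_colors i (cross_colors c i f) = cup_colors i f"
    by (cases c) (auto simp: color_defs fun_eq_iff)
  moreover have "m dvd cross_colors c i f i - cross_colors c i f (Suc i) \<longleftrightarrow> m dvd f i - f (Suc i)"
    by (cases c) (auto simp: algebra_simps)
  ultimately show ?thesis using R1_cup by simp
next
  case (R2 c i)
  have "cross_colors (\<not> c) i (cross_colors c i f) = f"
    by (cases c) (auto simp: fun_eq_iff)
  then show ?thesis using R2 by simp
next
  case (R3 b a c i)
  \<comment> \<open>In the six layered patterns the colours agree even as integers, because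
    reflection in \<open>2 * u - v\<close> is conjugate to reflection in \<open>v\<close> by
    reflection in \<open>u\<close>.\<close>
  have "cross_colors c i (cross_colors b (Suc i) (cross_colors a i f))
      = cross_colors a (Suc i) (cross_colors b i (cross_colors c (Suc i) f))"
    using R3(3) by (cases a; cases b; cases c) (auto simp: fun_eq_iff)
  then show ?thesis using R3 by simp
qed

lemma colorings_isotopic:
  assumes "m > 0" and "isotopic D E"
  shows "colorings m D = colorings m E"
proof -
  have *: "colorings m D = colorings m E" if "move_step D E" for D E
  proof -
    obtain u v a b where uv: "move a b" "D = u @ a @ v" "E = u @ b @ v"
      using \<open>move_step D E\<close> unfolding move_step_def by blast
    have "colorings m (a @ v) = colorings m (b @ v)"
      by (rule ext) (rule colorings_move[OF assms(1) uv(1)])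
    then show ?thesis
      unfolding uv(2,3) by (rule colorings_append_cong)
  qed
  have "equivclp move_step D E"
    using assms(2) by (simp add: isotopic_def)
  then show ?thesis
  proof (induction rule: equivclp_induct)
    case (step E F)
    then have "colorings m E = colorings m F"
      using *[of E F] *[of F E] by metis
    with step.IH show ?case by (rule trans)
  qed (rule refl)
qed

section \<open>Isotopy of tangles\<close>

text \<open>Isotopy relative to the ends: a local isotopy is proved once and then placed inside a
  closed diagram. The case \<open>k = l = 0\<close> is \<open>isotopic\<close>.\<close>

definition tangle_isotopic :: "nat \<Rightarrow> nat \<Rightarrow> bool slice list \<Rightarrow> bool slice list \<Rightarrow> bool" where
  "tangle_isotopic k l = equivclp (\<lambda>D D'. tangle k D l \<and> tangle k D' l \<and>
     (\<exists>u v a b. move a b \<and> D = u @ a @ v \<and> D' = u @ b @ v))"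

lemma isotopic_iff_tangle_isotopic: "isotopic D E \<longleftrightarrow> tangle_isotopic 0 0 D E"
  by (simp add: isotopic_def tangle_isotopic_def closed_diagram_def move_step_def[abs_def])

lemma tangle_isotopic_refl [simp]: "tangle_isotopic k l D D"
  by (simp add: tangle_isotopic_def)

lemma tangle_isotopic_sym [sym]: "tangle_isotopic k l D E \<Longrightarrow> tangle_isotopic k l E D"
  unfolding tangle_isotopic_def by (rule equivclp_sym)

lemma tangle_isotopic_trans [trans]:
  "tangle_isotopic k l D E \<Longrightarrow> tangle_isotopic k l E F \<Longrightarrow> tangle_isotopic k l D F"
  unfolding tangle_isotopic_def by (rule equivclp_trans)

lemma tangle_isotopic_move:
  "move a b \<Longrightarrow> tangle k a l \<Longrightarrow> tangle k b l \<Longrightarrow> tangle_isotopic k l a b"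
  unfolding tangle_isotopic_def
  by (rule r_into_equivclp) (metis append_Nil append_Nil2)

lemma tangle_isotopic_context:
  assumes "tangle_isotopic k l D E" and "tangle j u k" and "tangle l v m"
  shows "tangle_isotopic j m (u @ D @ v) (u @ E @ v)"
  using assms(1) unfolding tangle_isotopic_def[of k]
proof (induction rule: equivclp_induct)
  case (step E F)
  have "tangle_isotopic j m (u @ D @ v) (u @ E @ v)"
    if DE: "tangle k D l" "tangle k E l" "\<exists>u v a b. move a b \<and> D = u @ a @ v \<and> E = u @ b @ v" for D E
  proof -
    obtain u' v' a b where "move a b" "D = u' @ a @ v'" "E = u' @ b @ v'"
      using DE(3) by blast
    then have "\<exists>u' v' a b. move a b \<and> u @ D @ v = u' @ a @ v' \<and> u @ E @ v = u' @ b @ v'"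
      by - (rule exI[of _ "u @ u'"], rule exI[of _ "v' @ v"], auto)
    moreover have "tangle j (u @ D @ v) m" "tangle j (u @ E @ v) m"
      using DE(1,2) assms(2,3) by (blast intro: tangle_appendI)+
    ultimately show ?thesis
      unfolding tangle_isotopic_def by (blast intro: r_into_equivclp)
  qed
  then show ?case
    using step by (blast intro: tangle_isotopic_trans tangle_isotopic_sym)
qed simp

lemmas move_in_context = tangle_isotopic_context[OF tangle_isotopic_move]

section \<open>Columns of crossings and their reduction\<close>

definition twists :: "nat \<Rightarrow> bool list \<Rightarrow> bool slice list" where
  "twists i = map (\<lambda>b. Cross b i)"

lemma twists_simps [simp]:
  "twists i [] = []"
  "twists i (b # bs) = Cross b i # twists i bs"
  "twists i (bs @ bs') = twists i bs @ twists i bs'"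
  by (simp_all add: twists_def)

lemma tangle_twists: "i + 2 \<le> k \<Longrightarrow> tangle k (twists i bs) k"
  by (induction bs) (simp_all add: le_add_diff_inverse2 del: add_2_eq_Suc')

text \<open>This is the quarter turn of a single crossing. Sliding along the maximum flips the
  label; the crossing then lies left of the minimum, exchanges heights with it, and leaves a
  zigzag.\<close>

lemma tangle_isotopic_rotate_cross:
  assumes "3 \<le> k"
  shows "tangle_isotopic k k [Cap 1, Cross (\<not> c) 2, Cup 3] [Cross c 1]"
proof -
  have "tangle_isotopic k k [Cap 1, Cross (\<not> c) 2, Cup 3] [Cap 2, Cross c 1, Cup 3]"
    using assms tangle_isotopic_sym[OF move_in_context[OF slide_cap[of 1 c],
        of k "k + 2" k "[]" "[Cup 3]" k]]
    by (simp add: eval_nat_numeral)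
  also have "tangle_isotopic k k [Cap 2, Cross c 1, Cup 3] [Cap 2, Cup 3, Cross c 1]"
    using assms move_in_context[OF interchange[of "Cross c 1" "Cup 1"],
        of "k + 2" k k "[Cap 2]" "[]" k]
    by (simp add: eval_nat_numeral)
  also have "tangle_isotopic k k [Cap 2, Cup 3, Cross c 1] [Cross c 1]"
    using assms move_in_context[OF zigzag_left[of 2],
        of k k k "[]" "[Cross c 1]" k]
    by (simp add: eval_nat_numeral)
  finally show ?thesis .
qed

lemma tangle_isotopic_cap_twists:
  assumes "i + 2 \<le> k"
  shows "tangle_isotopic k (k + 2) ([Cap (i + 2)] @ twists i bs) (twists i bs @ [Cap (i + 2)])"
proof -
  obtain r where k: "k = i + 2 + r"
    using assms le_Suc_ex by blast
  show ?thesis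
  proof (induction bs)
    case (Cons b bs)
    have "tangle_isotopic k (k + 2) ([Cap (i + 2), Cross b i] @ twists i bs)
        ([Cross b i] @ [Cap (i + 2)] @ twists i bs)"
      using assms tangle_isotopic_sym[OF move_in_context[OF interchange[of "Cross b i" "Cap i"],
          of k "k + 2" k "[]" "twists i bs" "k + 2"]]
      by (simp add: tangle_twists k)
    also have "tangle_isotopic k (k + 2) \<dots> ([Cross b i] @ twists i bs @ [Cap (i + 2)])"
      using assms tangle_isotopic_context[OF Cons.IH, of k "[Cross b i]" "[]" "k + 2"] by (simp add: k)
    finally show ?case by simp
  qed simp
qed

lemma tangle_isotopic_twists_cup:
  assumes "i + 4 \<le> k"
  shows "tangle_isotopic k (k - 2) (twists (i + 2) bs @ [Cup i]) ([Cup i] @ twists i bs)"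
proof -
  obtain r where k: "k = i + 4 + r"
    using assms le_Suc_ex by blast
  show ?thesis
  proof (induction bs)
    case (Cons b bs)
    have "tangle_isotopic k (k - 2) ([Cross b (i + 2)] @ twists (i + 2) bs @ [Cup i])
        ([Cross b (i + 2)] @ [Cup i] @ twists i bs)"
      using assms tangle_isotopic_context[OF Cons.IH, of k "[Cross b (i + 2)]" "[]" "k - 2"] by (simp add: k)
    also have "tangle_isotopic k (k - 2) \<dots> ([Cup i, Cross b i] @ twists i bs)"
      using assms tangle_isotopic_sym[OF move_in_context[OF interchange[of "Cup i" "Cross b i"],
          of k "k - 2" k "[]" "twists i bs" "k - 2"]]
      by (simp add: tangle_twists k)
    finally show ?case by simp
  qed simp
qed

text \<open>The lowest crossing is a curl on the minimum, whence the induction from the end of the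
  list.\<close>

lemma tangle_isotopic_twists_R1:
  assumes "i + 2 \<le> k"
  shows "tangle_isotopic k (k - 2) (twists i bs @ [Cup i]) [Cup i]"
proof (induction bs rule: rev_induct)
  case (snoc b bs)
  have "tangle_isotopic k (k - 2) (twists i (bs @ [b]) @ [Cup i]) (twists i bs @ [Cup i])"
    using assms move_in_context[OF R1_cup[of b i],
        of k "k - 2" k "twists i bs" "[]" "k - 2"]
    by (simp add: tangle_twists)
  then show ?case using snoc.IH by (rule tangle_isotopic_trans)
qed simp

text \<open>The sign is read off the label alone, without orienting the strands, so this is the
  number of half twists and not the writhe.\<close>

definition twist_number :: "bool list \<Rightarrow> int" where
  "twist_number bs = (\<Sum>b\<leftarrow>bs. if b then 1 else - 1)"

lemma twist_number_simps [simp]: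
  "twist_number [] = 0"
  "twist_number (b # bs) = (if b then 1 else - 1) + twist_number bs"
  "twist_number (replicate p b) = (if b then int p else - int p)"
  by (auto simp: twist_number_def sum_list_replicate)

text \<open>A new crossing on top of a constant column either lengthens it or cancels against its
  first crossing by \<open>R2\<close>; both respect the twist number. If \<open>p = 0\<close>, the
  label \<open>e\<close> carries no information and can be replaced by \<open>b\<close>.\<close>

lemma tangle_isotopic_twists_reduce:
  assumes "i + 2 \<le> k"
  shows "\<exists>p e. tangle_isotopic k k (twists i bs) (twists i (replicate p e)) \<and>
    twist_number bs = twist_number (replicate p e)"
proof (induction bs)
  case Nil
  show ?case by (intro exI[of _ 0]) simp
next
  case (Cons b bs)
  then obtain p e where pe: "tangle_isotopic k k (twists i bs) (twists i (replicate p e))"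
    "twist_number bs = twist_number (replicate p e)" by blast
  have step: "tangle_isotopic k k (twists i (b # bs)) (twists i (b # replicate p e))"
    using assms tangle_isotopic_context[OF pe(1), of k "[Cross b i]" "[]" k] by simp
  show ?case
  proof (cases "p = 0 \<or> b = e")
    case True
    then have "b # replicate p e = replicate (Suc p) b" by auto
    with step pe(2) True show ?thesis
      by (intro exI[of _ "Suc p"] exI[of _ b]) auto
  next
    case False
    then obtain q where q: "p = Suc q" "e = (\<not> b)" by (cases p) auto
    have "tangle_isotopic k k (twists i (b # replicate p e)) (twists i (replicate q e))"
      using assms q move_in_context[OF R2[of b i],
          of k k k "[]" "twists i (replicate q e)" k]
      by (simp add: tangle_twists le_add_diff_inverse2 del: add_2_eq_Suc')
    with step pe(2) q show ?thesis
      by (intro exI[of _ q] exI[of _ e]) (auto intro: tangle_isotopic_trans)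
  qed
qed

text \<open>A constant list is determined by its twist number, the absolute value being the length
  and the sign giving the entry. Hence the reduced column has to be the given one.\<close>

lemma tangle_isotopic_twists_twist_number:
  assumes "i + 2 \<le> k" and "twist_number bs = twist_number (replicate p e)"
  shows "tangle_isotopic k k (twists i bs) (twists i (replicate p e))"
proof -
  obtain q d where q: "tangle_isotopic k k (twists i bs) (twists i (replicate q d))"
    "twist_number bs = twist_number (replicate q d)"
    using tangle_isotopic_twists_reduce[OF assms(1)] by blast
  then have "replicate q d = replicate p e"
    using assms(2) by (auto split: if_splits)
  with q(1) show ?thesis by simp
qed

section \<open>The quarter turn of the row\<close>

lemma tangle_caps_general: "2 \<le> k \<Longrightarrow> tangle k (map (\<lambda>j. Cap (2 * j + 2)) [0..<p]) (k + 2 * p)"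
  by (induction p) (auto simp: tangle_append)

lemma tangle_cups_general: "4 \<le> k \<Longrightarrow> tangle (k + 2 * p) (replicate p (Cup 2)) k"
  by (induction p) auto

text \<open>The last maximum lies to the right of all others and can be raised above them; at the
  top its position is \<open>2\<close>, as no other maximum shifts it yet.\<close>

lemma tangle_isotopic_cap_left:
  assumes "2 \<le> k"
  shows "tangle_isotopic k (k + 2 + 2 * p)
    (map (\<lambda>j. Cap (2 * j + 2)) [0..<p] @ [Cap (2 * p + 2)])
    ([Cap 2] @ map (\<lambda>j. Cap (2 * j + 2)) [0..<p])"
proof (induction p)
  case (Suc p)
  let ?C = "map (\<lambda>j. Cap (2 * j + 2)) [0..<p]"
  have "tangle_isotopic k (k + 2 + 2 * Suc p) (?C @ [Cap (2 * p + 2), Cap (2 * p + 2 + 2)])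
      (?C @ [Cap (2 * p + 2), Cap (2 * p + 2)])"
    using assms tangle_caps_general[of k p]
        move_in_context[OF interchange[of "Cap (2 * p + 2)" "Cap (2 * p + 2)"],
        of "k + 2 * p" "k + 2 + 2 * Suc p" k ?C "[]" "k + 2 + 2 * Suc p"]
    by (simp add: tangle_caps_general eval_nat_numeral)
  also have "tangle_isotopic k (k + 2 + 2 * Suc p) \<dots> ([Cap 2] @ ?C @ [Cap (2 * p + 2)])"
    using assms tangle_isotopic_context[OF Suc.IH, of k "[]" "[Cap (2 * p + 2)]" "k + 2 + 2 * Suc p"] by simp
  finally show ?case by simp
qed (simp add: numeral_2_eq_2)

text \<open>The crossing lies to the right of the minima, so it can sink below them; each minimum
  passed lowers its position by two.\<close>

lemma tangle_isotopic_cross_cups: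
  assumes "4 \<le> k"
  shows "tangle_isotopic (k + 1 + 2 * p) (k + 1) ([Cross c (2 * p + 3)] @ replicate p (Cup 2))
    (replicate p (Cup 2) @ [Cross c 3])"
proof (induction p)
  case (Suc p)
  have "tangle_isotopic (k + 1 + 2 * Suc p) (k + 1)
      ([Cross c (5 + 2 * p), Cup 2] @ replicate p (Cup 2))
      ([Cup 2, Cross c (2 * p + 3)] @ replicate p (Cup 2))"
    using assms tangle_cups_general[of "k + 1" p]
        tangle_isotopic_sym[OF move_in_context[OF interchange[of "Cup 2" "Cross c (2 * p + 3)"],
        of "k + 1 + 2 * Suc p" "k + 1 + 2 * p" "k + 1 + 2 * Suc p" "[]" "replicate p (Cup 2)" "k + 1"]]
    by (simp add: eval_nat_numeral)
  also have "tangle_isotopic (k + 1 + 2 * Suc p) (k + 1)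
      ([Cup 2, Cross c (2 * p + 3)] @ replicate p (Cup 2))
      ([Cup 2] @ replicate p (Cup 2) @ [Cross c 3])"
    using assms tangle_isotopic_context[OF Suc.IH, of "k + 1 + 2 * Suc p" "[Cup 2]" "[]" "k + 1"] by simp
  finally show ?case by simp
qed simp

text \<open>Induction on the row, splitting off its last crossing: its maximum goes to the top and
  the crossing below the earlier minima, the rest is turned by induction, and the last crossing is
  then slid onto the end of the column.\<close>

lemma tangle_isotopic_row:
  assumes "4 \<le> k"
  shows "tangle_isotopic k k
    (map (\<lambda>j. Cap (2 * j + 2)) [0..<p] @ map (\<lambda>j. Cross (f j) (2 * j + 1)) [0..<Suc p] @
      replicate p (Cup 2))
    ([Cap 1] @ twists 2 (map (\<lambda>j. \<not> f j) [0..<Suc p]) @ [Cup 3])"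
  using assms
proof (induction p arbitrary: k)
  case 0
  then show ?case
    using tangle_isotopic_sym[OF tangle_isotopic_rotate_cross[of k "f 0"]] by simp
next
  case (Suc p)
  let ?C = "map (\<lambda>j. Cap (2 * j + 2)) [0..<p]"
  let ?R = "map (\<lambda>j. Cross (f j) (2 * j + 1)) [0..<Suc p]"
  let ?U = "replicate p (Cup 2)"
  let ?T = "twists 2 (map (\<lambda>j. \<not> f j) [0..<Suc p])"
  let ?X = "Cross (f (Suc p)) (2 * p + 3)"
  have R: "tangle (k + 2 + 2 * p) ?R (k + 2 + 2 * p)"
    using Suc.prems by (intro tangle_row) simp
  have U: "tangle (k + 2 + 2 * p) ?U (k + 2)"
    using Suc.prems by (intro tangle_cups_general) simp
  have T: "tangle j ?T j" if "4 \<le> j" for j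
    using that by (intro tangle_twists) simp
  have C: "tangle (k + 2) ?C (k + 2 + 2 * p)"
    using Suc.prems by (intro tangle_caps_general) simp
  have XUU: "tangle (k + 2 + 2 * p) ([?X] @ ?U @ [Cup 2]) k"
    using Suc.prems tangle_appendI[OF U, of "[Cup 2]" k] by simp
  have "tangle_isotopic k k ((?C @ [Cap (2 * p + 2)]) @ ?R @ [?X] @ ?U @ [Cup 2])
      (([Cap 2] @ ?C) @ ?R @ [?X] @ ?U @ [Cup 2])"
    using Suc.prems tangle_isotopic_context[OF tangle_isotopic_cap_left[of k p], of k "[]"
        "?R @ [?X] @ ?U @ [Cup 2]" k] tangle_appendI[OF R XUU]
    by (simp del: upt_Suc)
  also have "tangle_isotopic k k \<dots> (([Cap 2] @ ?C @ ?R) @ (?U @ [Cross (f (Suc p)) 3]) @ [Cup 2])"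
    using Suc.prems tangle_isotopic_context[OF tangle_isotopic_cross_cups[of "k + 1" p "f (Suc p)"],
        of k
        "[Cap 2] @ ?C @ ?R" "[Cup 2]" k] tangle_appendI[OF C R]
    by (simp del: upt_Suc)
  \<comment> \<open>The raised maximum adds two strands, so the induction hypothesis is needed for
    \<open>k + 2\<close>.\<close>
  also have "tangle_isotopic k k \<dots> ([Cap 2] @ ([Cap 1] @ ?T @ [Cup 3]) @ [Cross (f (Suc p)) 3, Cup 2])"
    using Suc.prems tangle_isotopic_context[OF Suc.IH[of "k + 2"], of k
        "[Cap 2]" "[Cross (f (Suc p)) 3, Cup 2]" k]
    by (simp del: upt_Suc)
  also have "tangle_isotopic k k \<dots> ([Cap 2, Cap 1] @ ?T @ [Cup 3] @ [Cross (\<not> f (Suc p)) 2, Cup 3])"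
    using Suc.prems tangle_isotopic_sym[OF move_in_context[OF slide_cup[of "\<not> f (Suc p)" 2],
        of "k + 2" k k "[Cap 2, Cap 1] @ ?T @ [Cup 3]" "[]" k]]
      tangle_appendI[OF T[of "k + 4"], of "[Cup 3]" "k + 2"]
    by (simp add: eval_nat_numeral del: upt_Suc)
  \<comment> \<open>The surplus maximum now moves to the right of the column and down past it, until
    it cancels against the upper \<open>Cup 3\<close>.\<close>
  also have "tangle_isotopic k k \<dots> ([Cap 1, Cap 4] @ ?T @ [Cup 3] @ [Cross (\<not> f (Suc p)) 2, Cup 3])"
    using Suc.prems tangle_isotopic_sym[OF move_in_context[OF interchange[of "Cap 1" "Cap 2"],
        of k "k + 4" k "[]" "?T @ [Cup 3] @ [Cross (\<not> f (Suc p)) 2, Cup 3]" k]]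
      tangle_appendI[OF T[of "k + 4"], of "[Cup 3] @ [Cross (\<not> f (Suc p)) 2, Cup 3]" k]
    by (simp del: upt_Suc)
  also have "tangle_isotopic k k \<dots> ([Cap 1] @ (?T @ [Cap 4]) @ [Cup 3] @ [Cross (\<not> f (Suc p)) 2, Cup 3])"
    using Suc.prems tangle_isotopic_context[OF tangle_isotopic_cap_twists[of 2 "k + 2"],
        of k "[Cap 1]" "[Cup 3] @ [Cross (\<not> f (Suc p)) 2, Cup 3]" k]
    by (simp del: upt_Suc)
  also have "tangle_isotopic k k \<dots> ([Cap 1] @ ?T @ [Cross (\<not> f (Suc p)) 2, Cup 3])"
    using Suc.prems move_in_context[OF zigzag_right[of 3],
        of "k + 2" "k + 2" k "[Cap 1] @ ?T" "[Cross (\<not> f (Suc p)) 2, Cup 3]" k] T[of "k + 2"]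
    by (simp del: upt_Suc)
  finally show ?case by (simp add: replicate_append_same numeral_3_eq_3 flip: replicate_Suc)
qed

section \<open>Isotopies of the free knot\<close>

text \<open>The shape after the quarter turn: \<open>c\<close> and \<open>d\<close> label the
  original column, \<open>bs\<close> the turned row, and \<open>Cap 1\<close> and
  \<open>Cup 3\<close> come from the turn. For \<open>c = d\<close> and constant \<open>bs\<close>
  these are twist knots.\<close>

definition clasp_diagram :: "bool \<Rightarrow> bool \<Rightarrow> bool list \<Rightarrow> bool slice list" where
  "clasp_diagram c d bs =
    [Cap 0, Cap 2, Cross c 1, Cross d 1, Cap 1] @ twists 2 bs @ [Cup 3, Cup 0, Cup 0]"

lemma isotopic_assigned_clasp_diagram:
  assumes "n \<ge> 1"
  shows "isotopic (assigned_diagram n \<omega>)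
    (clasp_diagram (\<omega> 0) (\<omega> 1) (map (\<lambda>j. \<not> \<omega> (j + 2)) [0..<n]))"
proof -
  obtain p where n: "n = Suc p"
    using assms by (cases n) auto
  let ?u = "[Cap 0, Cap 2, Cross (\<omega> 0) 1, Cross (\<omega> 1) 1]"
  have "assigned_diagram n \<omega> = ?u @
      (map (\<lambda>j. Cap (2 * j + 2)) [0..<p] @
        map (\<lambda>j. Cross (\<omega> (j + 2)) (2 * j + 1)) [0..<Suc p] @ replicate p (Cup 2)) @
      [Cup 0, Cup 0]"
    by (simp add: assigned_diagram_def free_knot_def n comp_def del: upt_Suc)
  also have "tangle_isotopic 0 0 \<dots> (?u @
      ([Cap 1] @ twists 2 (map (\<lambda>j. \<not> \<omega> (j + 2)) [0..<Suc p]) @ [Cup 3]) @ [Cup 0, Cup 0])"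
    by (rule tangle_isotopic_context[OF tangle_isotopic_row[of 4]]) simp_all
  finally show ?thesis
    by (simp add: isotopic_iff_tangle_isotopic clasp_diagram_def n del: upt_Suc)
qed

text \<open>Raising the left minimum above the column leaves the column directly on the last
  minimum, where all its crossings are curls.\<close>

lemma tangle_isotopic_curls:
  "tangle_isotopic 0 0 ([Cap 0, Cap 1] @ twists 2 bs @ [Cup 0, Cup 0]) unknot"
proof -
  have "tangle_isotopic 0 0 ([Cap 0, Cap 1] @ twists 2 bs @ [Cup 0, Cup 0])
      ([Cap 0, Cap 1, Cup 0] @ twists 0 bs @ [Cup 0])"
    using tangle_isotopic_context[OF tangle_isotopic_twists_cup[of 0 4 bs],
        of 0 "[Cap 0, Cap 1]" "[Cup 0]" 0]
    by (simp add: numeral_2_eq_2)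
  also have "tangle_isotopic 0 0 \<dots> [Cap 0, Cap 1, Cup 0, Cup 0]"
    using tangle_isotopic_context[OF tangle_isotopic_twists_R1[of 0 2 bs],
        of 0 "[Cap 0, Cap 1, Cup 0]" "[]" 0]
    by simp
  also have "tangle_isotopic 0 0 \<dots> unknot"
    using move_in_context[OF zigzag_right[of 0],
        of 2 2 0 "[Cap 0]" "[Cup 0]" 0]
    by (simp add: unknot_def)
  finally show ?thesis .
qed

text \<open>Once \<open>R2\<close> has removed the clasp, the maximum \<open>Cap 2\<close> is free
  to pass down to the right of the turned row and to cancel against \<open>Cup 3\<close>, which
  leaves only curls.\<close>

lemma isotopic_clasp_diagram_cancel: "isotopic (clasp_diagram c (\<not> c) bs) unknot"
proof -
  have T: "tangle 6 (twists 2 bs) 6" "tangle 4 (twists 2 bs) 4"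
    by (rule tangle_twists, simp)+
  let ?v = "twists 2 bs @ [Cup 3, Cup 0, Cup 0]"
  have v: "tangle 6 ?v 0"
    by (rule tangle_appendI[OF T(1)]) simp
  have "tangle_isotopic 0 0 (clasp_diagram c (\<not> c) bs) ([Cap 0] @ [Cap 2, Cap 1] @ ?v)"
    using v move_in_context[OF R2[of c 1],
        of 4 4 0 "[Cap 0, Cap 2]" "Cap 1 # ?v" 0]
    by (simp add: clasp_diagram_def)
  also have "tangle_isotopic 0 0 \<dots> ([Cap 0] @ [Cap 1, Cap 4] @ ?v)"
    using v tangle_isotopic_sym[OF move_in_context[OF interchange[of "Cap 1" "Cap 2"],
        of 2 6 0 "[Cap 0]" ?v 0]]
    by simp
  also have "tangle_isotopic 0 0 \<dots> ([Cap 0, Cap 1] @ twists 2 bs @ [Cap 4, Cup 3, Cup 0, Cup 0])"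
    using tangle_isotopic_context[OF tangle_isotopic_cap_twists[of 2 4 bs],
        of 0 "[Cap 0, Cap 1]" "[Cup 3, Cup 0, Cup 0]" 0]
    by simp
  also have "tangle_isotopic 0 0 \<dots> ([Cap 0, Cap 1] @ twists 2 bs @ [Cup 0, Cup 0])"
    using T(2) move_in_context[OF zigzag_right[of 3],
        of 4 4 0 "[Cap 0, Cap 1] @ twists 2 bs" "[Cup 0, Cup 0]" 0]
    by (simp add: eval_nat_numeral)
  also note tangle_isotopic_curls
  finally show ?thesis by (simp add: isotopic_iff_tangle_isotopic)
qed

lemma tangle_isotopic_clasp_diagram_reduce:
  assumes "twist_number bs = twist_number (replicate p e)"
  shows "tangle_isotopic 0 0 (clasp_diagram c d bs) (clasp_diagram c d (replicate p e))"
  using tangle_isotopic_context[OF tangle_isotopic_twists_twist_number[OF _ assms, of 2 6],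
      of 0 "[Cap 0, Cap 2, Cross c 1, Cross d 1, Cap 1]" "[Cup 3, Cup 0, Cup 0]" 0]
  by (simp add: clasp_diagram_def)

text \<open>With the turned row gone, \<open>Cup 3\<close> can be raised above \<open>Cap 1\<close>;
  it then closes off the clasp from below, whose crossings become curls whatever their
  labels.\<close>

lemma isotopic_clasp_diagram_twist_number_0:
  assumes "twist_number bs = 0"
  shows "isotopic (clasp_diagram c d bs) unknot"
proof -
  have "tangle_isotopic 0 0 (clasp_diagram c d bs) (clasp_diagram c d [])"
    using tangle_isotopic_clasp_diagram_reduce[of bs 0] assms by simp
  also have "tangle_isotopic 0 0 \<dots> ([Cap 0, Cap 2] @ twists 1 [c, d] @ [Cup 1, Cap 1, Cup 0, Cup 0])"
    using move_in_context[OF interchange[of "Cap 1" "Cup 1"],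
        of 4 4 0 "[Cap 0, Cap 2, Cross c 1, Cross d 1]" "[Cup 0, Cup 0]" 0]
    by (simp add: clasp_diagram_def eval_nat_numeral)
  also have "tangle_isotopic 0 0 \<dots> [Cap 0, Cap 2, Cup 1, Cap 1, Cup 0, Cup 0]"
    using tangle_isotopic_context[OF tangle_isotopic_twists_R1[of 1 4 "[c, d]"],
        of 0 "[Cap 0, Cap 2]" "[Cap 1, Cup 0, Cup 0]" 0]
    by simp
  also have "tangle_isotopic 0 0 \<dots> ([Cap 0, Cap 1] @ twists 2 [] @ [Cup 0, Cup 0])"
    using move_in_context[OF zigzag_right[of 1],
        of 2 2 0 "[Cap 0]" "[Cap 1, Cup 0, Cup 0]" 0]
    by (simp add: eval_nat_numeral)
  also note tangle_isotopic_curls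
  finally show ?thesis by (simp add: isotopic_iff_tangle_isotopic)
qed

text \<open>A single remaining crossing is turned back and joins the clasp as its third crossing,
  with flipped label.\<close>

lemma tangle_isotopic_clasp_diagram_twist_number_1:
  assumes "twist_number bs = twist_number [e]"
  shows "tangle_isotopic 0 0 (clasp_diagram c d bs)
    ([Cap 0, Cap 2] @ twists 1 [c, d, \<not> e] @ [Cup 0, Cup 0])"
proof -
  have "tangle_isotopic 0 0 (clasp_diagram c d bs) (clasp_diagram c d [e])"
    using tangle_isotopic_clasp_diagram_reduce[of bs 1 e] assms by simp
  also have "tangle_isotopic 0 0 \<dots> ([Cap 0, Cap 2] @ twists 1 [c, d, \<not> e] @ [Cup 0, Cup 0])"
    using tangle_isotopic_context[OF tangle_isotopic_rotate_cross[of 4 "\<not> e"],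
        of 0 "[Cap 0, Cap 2, Cross c 1, Cross d 1]" "[Cup 0, Cup 0]" 0]
    by (simp add: clasp_diagram_def)
  finally show ?thesis .
qed

text \<open>The third crossing cancels one crossing of the clasp, and the other becomes a
  curl.\<close>

lemma isotopic_clasp_diagram_unknot:
  assumes "twist_number bs = twist_number [c]"
  shows "isotopic (clasp_diagram c c bs) unknot"
proof -
  have "tangle_isotopic 0 0 (clasp_diagram c c bs)
      ([Cap 0, Cap 2] @ twists 1 [c, c, \<not> c] @ [Cup 0, Cup 0])"
    by (rule tangle_isotopic_clasp_diagram_twist_number_1[OF assms])
  also have "tangle_isotopic 0 0 \<dots> [Cap 0, Cap 2, Cross c 1, Cup 0, Cup 0]"
    using move_in_context[OF R2[of c 1],
        of 4 4 0 "[Cap 0, Cap 2, Cross c 1]" "[Cup 0, Cup 0]" 0]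
    by simp
  also have "tangle_isotopic 0 0 \<dots> ([Cap 0, Cap 1] @ twists 2 [\<not> c] @ [Cup 0, Cup 0])"
    using move_in_context[OF slide_cap[of 1 c],
        of 2 4 0 "[Cap 0]" "[Cup 0, Cup 0]" 0]
    by (simp add: eval_nat_numeral)
  also note tangle_isotopic_curls
  finally show ?thesis by (simp add: isotopic_iff_tangle_isotopic)
qed

lemma mirror_unknot [simp]: "mirror unknot = unknot"
  by (simp add: mirror_def unknot_def)

text \<open>The third crossing receives the label \<open>c\<close> as well, which gives
  \<open>trefoil\<close> or its mirror image according to \<open>c\<close>.\<close>

lemma same_knot_clasp_diagram_trefoil:
  assumes "twist_number bs = twist_number [\<not> c]"
  shows "same_knot (clasp_diagram c c bs) trefoil"
  using tangle_isotopic_clasp_diagram_twist_number_1[OF assms, of c c]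
  by (cases c) (simp_all add: same_knot_def isotopic_iff_tangle_isotopic trefoil_def mirror_def)

section \<open>Colourings of the clasp diagrams\<close>

lemma colorings_unknot: "colorings m unknot f = nat m"
  by (simp add: unknot_def cap_colors_def)

text \<open>Every crossing preserves the difference of the two colours and adds that difference to
  both of them, with the sign of its label.\<close>

lemma colorings_twists:
  "colorings m (twists i bs @ D) f = colorings m D
    (f(i := f i + twist_number bs * (f i - f (Suc i)), Suc i := f (Suc i) + twist_number bs * (f i - f (Suc i))))"
proof (induction bs arbitrary: f)
  case (Cons b bs)
  show ?case
    by (cases b)
      (auto simp: Cons.IH fun_eq_iff algebra_simps intro!: arg_cong[of _ _ "colorings m D"])
qed simp

lemma colorings_three_twists:
  "colorings m ([Cap 0, Cap 2] @ twists 1 [b, b, b] @ [Cup 0, Cup 0]) f =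
    (\<Sum>p\<in>{0..<m}. \<Sum>q\<in>{0..<m}. if m dvd 3 * (p - q) then 1 else 0)"
proof -
  have "m dvd 3 * q - 3 * p \<longleftrightarrow> m dvd 3 * p - 3 * q" for p q
    by (rule dvd_diff_commute)
  then show ?thesis
    by (cases b) (simp_all add: colorings_twists color_defs algebra_simps cong: if_cong del: twists_simps(2))
qed

text \<open>The value \<open>nat m ^ 2\<close> requires every choice of \<open>p\<close> and
  \<open>q\<close> to be a colouring, but if \<open>m\<close> does not divide \<open>3\<close>, the
  choice \<open>p = 1\<close>, \<open>q = 0\<close> fails.\<close>

lemma dvd_3_if_colorings_three_twists:
  assumes "m > 0"
    and "colorings m ([Cap 0, Cap 2] @ twists 1 [b, b, b] @ [Cup 0, Cup 0]) f = nat m ^ 2"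
  shows "m dvd 3"
proof (rule ccontr)
  let ?g = "\<lambda>p. \<Sum>q\<in>{0..<m}. if m dvd 3 * (p - q) then 1 else 0 :: nat"
  assume "\<not> m dvd 3"
  then have "m > 1"
    using assms(1) by (cases "m = 1") auto
  have "?g p \<le> (\<Sum>q\<in>{0..<m}. 1)" for p
    by (rule sum_mono) simp
  moreover have "?g 1 < (\<Sum>q\<in>{0..<m}. 1)"
    by (rule sum_strict_mono_ex1) (use \<open>m > 1\<close> \<open>\<not> m dvd 3\<close> in \<open>auto intro: bexI[of _ 0]\<close>)
  ultimately have "(\<Sum>p\<in>{0..<m}. ?g p) < (\<Sum>p\<in>{0..<m}. nat m)"
    using \<open>m > 1\<close> by (intro sum_strict_mono_ex1) (auto intro!: bexI[of _ 1])
  then show False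
    using assms by (simp only: colorings_three_twists) (simp add: power2_eq_square)
qed

lemma colorings_three_twists_mod_3:
  "colorings 3 ([Cap 0, Cap 2] @ twists 1 [b, b, b] @ [Cup 0, Cup 0]) f = 9"
  by (simp only: colorings_three_twists) simp

text \<open>Mirroring only flips the common label; this puts the mirror clause into a form to which
  isotopy invariance applies.\<close>

lemma same_knot_trefoil_iff:
  "same_knot D trefoil \<longleftrightarrow>
    (\<exists>b. isotopic D ([Cap 0, Cap 2] @ twists 1 [b, b, b] @ [Cup 0, Cup 0]))"
  by (simp add: same_knot_def trefoil_def mirror_def ex_bool_eq)

text \<open>Modulo a divisor of the determinant, the colours of the two upper maxima can be chosen
  freely and determine that of the third.\<close>

lemma colorings_clasp_diagram:
  assumes "m > 0" and m: "m dvd 1 - 2 * (twist_number [c] * twist_number bs)"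
  shows "colorings m (clasp_diagram c c bs) f = nat m ^ 2"
proof -
  define g w where "g = twist_number [c]" and "w = twist_number bs"
  have eq: "clasp_diagram c c bs =
      [Cap 0, Cap 2] @ twists 1 [c, c] @ [Cap 1] @ twists 2 bs @ [Cup 3, Cup 0, Cup 0]"
    by (simp add: clasp_diagram_def)
  have g: "twist_number [c, c] = 2 * g"
    by (simp add: g_def)
  \<comment> \<open>\<open>p\<close>, \<open>q\<close> and \<open>r\<close> are the colours of
    \<open>Cap 0\<close>, \<open>Cap 2\<close> and \<open>Cap 1\<close>. The first
    \<open>Cup 0\<close> forces \<open>r = p\<close>; the other two minima then both ask that
    \<open>m\<close> divide \<open>(p - q) * (1 - 2 * (g * w))\<close>.\<close>
  have inner: "(\<Sum>r\<in>{0..<m}.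
      if m dvd p + 2 * g * (p - q) + w * (r - (p + 2 * g * (p - q))) - (q + 2 * g * (p - q))
      then if m dvd p - r
        then if m dvd r + w * (r - (p + 2 * g * (p - q))) - q then 1 else 0 else 0 else 0) = (1 :: nat)"
    (is "(\<Sum>r\<in>_. ?F r) = 1") if p: "p \<in> {0..<m}" for p q
  proof -
    have d: "m dvd (p - q) * (1 - 2 * (g * w))"
      using m by (simp add: g_def w_def)
    have "m dvd p - r \<longleftrightarrow> r = p" if "r \<in> {0..<m}" for r
      using that p by (auto simp flip: mod_eq_dvd_iff)
    then have "(\<Sum>r\<in>{0..<m}. ?F r) = (\<Sum>r\<in>{0..<m}. if r = p then 1 else 0)"
      using d by (intro sum.cong) (auto simp: algebra_simps)
    also have "\<dots> = 1"
      using p by simp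
    finally show ?thesis .
  qed
  have "colorings m (clasp_diagram c c bs) f = (\<Sum>p\<in>{0..<m}. \<Sum>q\<in>{0..<m}. \<Sum>r\<in>{0..<m}.
      if m dvd p + 2 * g * (p - q) + w * (r - (p + 2 * g * (p - q))) - (q + 2 * g * (p - q))
      then if m dvd p - r
        then if m dvd r + w * (r - (p + 2 * g * (p - q))) - q then 1 else 0 else 0 else 0)"
    unfolding eq
    by (simp add: colorings_twists color_defs g w_def[symmetric] eval_nat_numeral
        cong: if_cong del: twists_simps(2) twist_number_simps)
  also have "\<dots> = (\<Sum>p\<in>{0..<m}. \<Sum>q\<in>{0..<m}. 1)"
    by (intro sum.cong refl inner)
  also have "\<dots> = nat m ^ 2"
    by (simp add: power2_eq_square)
  finally show ?thesis .
qed

section \<open>Recognition of the unknot and the trefoil\<close>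

lemma same_knot_isotopic: "isotopic D E \<Longrightarrow> same_knot D K \<longleftrightarrow> same_knot E K"
  unfolding same_knot_def isotopic_def by (metis equivclp_sym equivclp_trans)

lemma same_knot_unknot_clasp_diagram:
  "same_knot (clasp_diagram c c bs) unknot \<longleftrightarrow> twist_number bs = 0 \<or> twist_number bs = twist_number [c]"
proof
  assume "same_knot (clasp_diagram c c bs) unknot"
  then have iso: "isotopic (clasp_diagram c c bs) unknot"
    by (simp add: same_knot_def)
  \<comment> \<open>The largest modulus for which \<open>colorings_clasp_diagram\<close> gives the
    square. It is odd, hence positive, and equals \<open>1\<close> only if the twist number relative
    to the clasp is \<open>0\<close> or \<open>1\<close>.\<close>
  define m where "m = \<bar>1 - 2 * (twist_number [c] * twist_number bs)\<bar>"
  have "m > 0"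
    unfolding m_def by presburger
  then have "nat m ^ 2 = nat m"
    using colorings_isotopic[OF _ iso, of m] colorings_clasp_diagram[of m c bs]
      colorings_unknot[of m] by (simp add: m_def fun_eq_iff)
  with \<open>m > 0\<close> have "m = 1"
    by (simp add: power2_eq_square)
  then show "twist_number bs = 0 \<or> twist_number bs = twist_number [c]"
    unfolding m_def by (cases c) (simp_all, presburger+)
next
  assume "twist_number bs = 0 \<or> twist_number bs = twist_number [c]"
  then show "same_knot (clasp_diagram c c bs) unknot"
    by (auto simp: same_knot_def isotopic_clasp_diagram_twist_number_0 simp del: twist_number_simps
        intro: isotopic_clasp_diagram_unknot)
qed

text \<open>Modulo \<open>3\<close> the unknot has three colourings, the trefoil and its mirror
  image nine.\<close>

lemma not_same_knot_trefoil:
  assumes "isotopic D unknot"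
  shows "\<not> same_knot D trefoil"
proof
  assume "same_knot D trefoil"
  then have "same_knot unknot trefoil"
    using same_knot_isotopic[OF assms] by simp
  then obtain b where "isotopic unknot ([Cap 0, Cap 2] @ twists 1 [b, b, b] @ [Cup 0, Cup 0])"
    unfolding same_knot_trefoil_iff by blast
  then have "colorings 3 unknot (\<lambda>_. 0) = 9"
    by (subst colorings_isotopic) (auto simp only: colorings_three_twists_mod_3)
  then show False
    by (simp add: colorings_unknot)
qed

lemma same_knot_trefoil_clasp_diagram:
  assumes "odd (twist_number bs)"
  shows "same_knot (clasp_diagram c c bs) trefoil \<longleftrightarrow> twist_number bs = twist_number [\<not> c]"
proof
  assume same: "same_knot (clasp_diagram c c bs) trefoil"
  define m where "m = \<bar>1 - 2 * (twist_number [c] * twist_number bs)\<bar>"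
  have "m > 0"
    unfolding m_def by presburger
  obtain b where "isotopic (clasp_diagram c c bs)
      ([Cap 0, Cap 2] @ twists 1 [b, b, b] @ [Cup 0, Cup 0])"
    using same unfolding same_knot_trefoil_iff by blast
  from colorings_isotopic[OF \<open>m > 0\<close> this] have "m dvd 3"
    using \<open>m > 0\<close> colorings_clasp_diagram[of m c bs]
    by (intro dvd_3_if_colorings_three_twists[of m b "\<lambda>_. 0"]) (auto simp: m_def)
  \<comment> \<open>For the twist number relative to the clasp this leaves \<open>-1\<close>,
    \<open>0\<close>, \<open>1\<close> and \<open>2\<close>. Parity excludes \<open>0\<close> and
    \<open>2\<close>, and \<open>1\<close> belongs to the unknot.\<close>
  then have "m \<le> 3"
    by (rule zdvd_imp_le) simp
  moreover have "twist_number bs \<noteq> twist_number [c]"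
    using same not_same_knot_trefoil isotopic_clasp_diagram_unknot by blast
  ultimately show "twist_number bs = twist_number [\<not> c]"
    using assms unfolding m_def by (cases c) (simp_all add: abs_le_iff, presburger+)
qed (rule same_knot_clasp_diagram_trefoil)

lemma twist_number_map_Not: "twist_number (map Not bs) = - twist_number bs"
  by (induction bs) auto

lemma twist_number_conv_count_list: "twist_number [c] * twist_number bs = 2 * int (count_list bs c) - int (length bs)"
  by (induction bs) auto

section \<open>Counting assignments\<close>

text \<open>Splitting by the first entry gives Pascal's rule.\<close>

lemma card_count_list:
  "card {bs :: bool list. length bs = n \<and> count_list bs c = k} = n choose k"
proof (induction n arbitrary: k)
  case 0
  have "{bs. length bs = 0 \<and> count_list bs c = k} = (if k = 0 then {[]} else {})"
    by auto
  then show ?case by simp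
next
  case (Suc n)
  let ?A = "\<lambda>n k. {bs. length bs = n \<and> count_list bs c = k}"
  have fin: "finite (?A n k)" for n k
    by (rule finite_subset[OF _ finite_lists_length_eq[of UNIV n]]) auto
  show ?case
  proof (cases k)
    case 0
    have "?A (Suc n) k = Cons (\<not> c) ` ?A n k"
      unfolding 0 by (auto simp: length_Suc_conv image_iff split: if_splits)
    then show ?thesis using Suc[of k] 0 by (simp add: card_image)
  next
    case (Suc l)
    have "?A (Suc n) k = Cons c ` ?A n l \<union> Cons (\<not> c) ` ?A n k"
      unfolding Suc by (auto simp: length_Suc_conv image_iff split: if_splits)
    also have "card \<dots> = card (Cons c ` ?A n l) + card (Cons (\<not> c) ` ?A n k)"
      by (rule card_Un_disjoint) (auto simp: fin)
    finally show ?thesis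
      using Suc.IH[of l] Suc.IH[of k] Suc by (simp add: card_image)
  qed
qed

lemma bij_betw_map_upt_PiE:
  "bij_betw (\<lambda>\<omega>. map \<omega> [0..<N]) ({..<N} \<rightarrow>\<^sub>E UNIV) {bs. length bs = N}"
proof (rule bij_betwI[where g = "\<lambda>bs. restrict ((!) bs) {..<N}"])
  show "(\<lambda>\<omega>. map \<omega> [0..<N]) \<in> ({..<N} \<rightarrow>\<^sub>E UNIV) \<rightarrow> {bs. length bs = N}"
    by auto
  show "restrict ((!) (map \<omega> [0..<N])) {..<N} = \<omega>" if "\<omega> \<in> {..<N} \<rightarrow>\<^sub>E UNIV" for \<omega>
    using that by (intro ext) (auto simp: restrict_def PiE_iff extensional_def)
  show "map (restrict ((!) bs) {..<N}) [0..<N] = bs" if "bs \<in> {bs. length bs = N}" for bs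
    using that by (intro nth_equalityI) auto
qed auto

text \<open>Separates the two labels of the column, which select the case, from the labels of the
  row, of which only a count will matter.\<close>

lemma card_assignments_Collect:
  assumes "\<And>\<omega>. P \<omega> \<longleftrightarrow> Q (\<omega> 0) (\<omega> 1) (map (\<lambda>j. \<omega> (j + 2)) [0..<n])"
  shows "card {\<omega> \<in> assignments n. P \<omega>} =
    (\<Sum>(c, d)\<in>UNIV. card {bs. length bs = n \<and> Q c d bs})"
proof -
  let ?h = "\<lambda>\<omega> :: nat \<Rightarrow> bool. map \<omega> [0..<n + 2]"
  let ?L = "\<lambda>(c, d). {bs. length bs = n \<and> Q c d bs}"
  have h: "?h \<omega> = \<omega> 0 # \<omega> 1 # map (\<lambda>j. \<omega> (j + 2)) [0..<n]" for \<omega>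
  proof -
    have "[0..<n + 2] = 0 # 1 # map (\<lambda>j. j + 2) [0..<n]"
      unfolding map_add_upt by (simp add: upt_conv_Cons numeral_2_eq_2 del: upt_Suc)
    then show ?thesis by simp
  qed
  have bij: "bij_betw ?h (assignments n) {bs. length bs = n + 2}"
    unfolding assignments_def by (rule bij_betw_map_upt_PiE)
  have "card {\<omega> \<in> assignments n. P \<omega>} = card (?h ` {\<omega> \<in> assignments n. P \<omega>})"
    using bij by (intro card_image[symmetric] inj_on_subset[OF bij_betw_imp_inj_on[OF bij]]) auto
  also have "?h ` {\<omega> \<in> assignments n. P \<omega>} = (\<lambda>((c, d), bs). c # d # bs) ` Sigma UNIV ?L"
  proof (intro equalityI subsetI)
    fix xs assume "xs \<in> ?h ` {\<omega> \<in> assignments n. P \<omega>}"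
    then obtain \<omega> where "xs = ?h \<omega>" "P \<omega>" by blast
    then show "xs \<in> (\<lambda>((c, d), bs). c # d # bs) ` Sigma UNIV ?L"
      using assms[of \<omega>] unfolding h
      by (intro image_eqI[of _ _ "((\<omega> 0, \<omega> 1), map (\<lambda>j. \<omega> (j + 2)) [0..<n])"]) auto
  next
    fix xs assume "xs \<in> (\<lambda>((c, d), bs). c # d # bs) ` Sigma UNIV ?L"
    then obtain c d bs where xs: "xs = c # d # bs" "length bs = n" "Q c d bs" by auto
    then have "xs \<in> ?h ` assignments n"
      using bij by (simp add: bij_betw_def)
    then obtain \<omega> where \<omega>: "\<omega> \<in> assignments n" "xs = ?h \<omega>" by blast
    with xs have "P \<omega>"
      unfolding h assms by auto
    with \<omega> show "xs \<in> ?h ` {\<omega> \<in> assignments n. P \<omega>}" by blast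
  qed
  also have "card \<dots> = card (Sigma UNIV ?L)"
    by (rule card_image) (auto simp: inj_on_def)
  also have "\<dots> = (\<Sum>x\<in>UNIV. card (?L x))"
    by (rule card_SigmaI)
      (auto intro: finite_subset[OF _ finite_lists_length_eq[of UNIV n]])
  also have "\<dots> = (\<Sum>(c, d)\<in>UNIV. card {bs. length bs = n \<and> Q c d bs})"
    by (intro sum.cong) auto
  finally show ?thesis .
qed

lemma sum_bool_pairs:
  "(\<Sum>(c, d)\<in>UNIV. g c d) = g True True + g True False + g False True + (g False False :: nat)"
  by (simp add: UNIV_bool flip: UNIV_Times_UNIV sum.cartesian_product)

section \<open>The knot type in terms of the labels\<close>

lemma same_knot_unknot_assigned_diagram:
  fixes \<omega> :: "nat \<Rightarrow> bool" and n :: nat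
  defines "ys \<equiv> map (\<lambda>j. \<omega> (j + 2)) [0..<n]"
  assumes "n \<ge> 1"
  shows "same_knot (assigned_diagram n \<omega>) unknot \<longleftrightarrow>
    \<omega> 0 \<noteq> \<omega> 1 \<or> count_list ys (\<omega> 0) = n div 2"
proof -
  have ys: "map (\<lambda>j. \<not> \<omega> (j + 2)) [0..<n] = map Not ys" "length ys = n"
    by (simp_all add: ys_def)
  note iso = same_knot_isotopic[OF isotopic_assigned_clasp_diagram[OF assms(2)], of \<omega>, unfolded ys]
  show ?thesis
  proof (cases "\<omega> 0 = \<omega> 1")
    case True
    \<comment> \<open>With \<open>k\<close> entries of \<open>ys\<close> equal to
      \<open>\<omega> 0\<close>, the turned row has relative twist number \<open>n - 2 * k\<close>.
      Its parity is that of \<open>n\<close>, so the values \<open>0\<close> and \<open>1\<close>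
      together amount to \<open>k = n div 2\<close>.\<close>
    have "twist_number (map Not ys) = 0 \<or> twist_number (map Not ys) = twist_number [\<omega> 0] \<longleftrightarrow>
        count_list ys (\<omega> 0) = n div 2"
      using twist_number_conv_count_list[of "\<omega> 0" ys] ys(2)
      by (cases "\<omega> 0") (simp_all add: twist_number_map_Not, presburger+)
    then show ?thesis
      unfolding iso True[symmetric] same_knot_unknot_clasp_diagram by simp
  next
    case False
    then have "\<omega> 1 = (\<not> \<omega> 0)" by auto
    then show ?thesis
      unfolding iso using isotopic_clasp_diagram_cancel by (simp add: same_knot_def)
  qed
qed

lemma same_knot_trefoil_assigned_diagram:
  fixes \<omega> :: "nat \<Rightarrow> bool" and n :: nat
  defines "ys \<equiv> map (\<lambda>j. \<omega> (j + 2)) [0..<n]"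
  assumes "odd n"
  shows "same_knot (assigned_diagram n \<omega>) trefoil \<longleftrightarrow>
    \<omega> 0 = \<omega> 1 \<and> count_list ys (\<omega> 0) = n - (n - 1) div 2"
proof -
  have "n \<ge> 1"
    using assms(2) by (cases n) auto
  have ys: "map (\<lambda>j. \<not> \<omega> (j + 2)) [0..<n] = map Not ys" "length ys = n"
    by (simp_all add: ys_def)
  note iso = same_knot_isotopic[OF isotopic_assigned_clasp_diagram[OF \<open>n \<ge> 1\<close>], of \<omega>, unfolded ys]
  show ?thesis
  proof (cases "\<omega> 0 = \<omega> 1")
    case True
    have eq: "twist_number [\<omega> 0] * twist_number ys = 2 * int (count_list ys (\<omega> 0)) - int n"
      using twist_number_conv_count_list[of "\<omega> 0" ys] ys(2) by simp
    have "odd (twist_number [\<omega> 0] * twist_number ys)"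
      unfolding eq using assms(2) by simp
    then have "odd (twist_number (map Not ys))"
      by (simp add: twist_number_map_Not)
    note this[THEN same_knot_trefoil_clasp_diagram, of "\<omega> 0"]
    \<comment> \<open>The relative twist number \<open>n - 2 * k\<close> is \<open>-1\<close> for
      \<open>k = (n + 1) div 2\<close>, written here so that the symmetry of the binomial
      coefficients applies.\<close>
    moreover have "twist_number (map Not ys) = twist_number [\<not> \<omega> 0] \<longleftrightarrow>
        count_list ys (\<omega> 0) = n - (n - 1) div 2"
      using eq assms(2) by (cases "\<omega> 0") (simp_all add: twist_number_map_Not, presburger+)
    ultimately show ?thesis
      unfolding iso True[symmetric] by simp
  next
    case False
    then have "\<omega> 1 = (\<not> \<omega> 0)" by auto
    then show ?thesis
      unfolding iso using not_same_knot_trefoil[OF isotopic_clasp_diagram_cancel] by simp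
  qed
qed

theorem theorem5p2:
  fixes n :: nat
  assumes "n \<ge> 1"
  shows
    "(odd n \<longrightarrow>
        card {\<omega> \<in> assignments n. same_knot (assigned_diagram n \<omega>) unknot}
          = 2 ^ (n + 1) + 2 * (n choose ((n - 1) div 2)) \<and>
        card {\<omega> \<in> assignments n. same_knot (assigned_diagram n \<omega>) trefoil}
          = 2 * (n choose ((n - 1) div 2))) \<and>
     (even n \<longrightarrow>
        card {\<omega> \<in> assignments n. same_knot (assigned_diagram n \<omega>) unknot}
          = 2 ^ (n + 1) + 2 * (n choose (n div 2)))"
proof -
  have lists: "card {bs :: bool list. length bs = n} = 2 ^ n"
    using card_lists_length_eq[of "UNIV :: bool set" n] by simp
  \<comment> \<open>The two pairs of unequal column labels contribute \<open>2 ^ n\<close> each, the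
    two pairs of equal ones a binomial coefficient each.\<close>
  have "card {\<omega> \<in> assignments n. same_knot (assigned_diagram n \<omega>) unknot} =
      2 ^ (n + 1) + 2 * (n choose (n div 2))"
    unfolding card_assignments_Collect[where Q = "\<lambda>c d bs. c \<noteq> d \<or> count_list bs c = n div 2",
        OF same_knot_unknot_assigned_diagram[OF assms]] sum_bool_pairs
    by (simp add: lists card_count_list)
  moreover have "card {\<omega> \<in> assignments n. same_knot (assigned_diagram n \<omega>) trefoil} =
      2 * (n choose ((n - 1) div 2))" if "odd n"
  proof -
    have "n choose (n - (n - 1) div 2) = n choose ((n - 1) div 2)"
      by (rule binomial_symmetric[symmetric]) simp
    then show ?thesis
      unfolding card_assignments_Collect[where
          Q = "\<lambda>c d bs. c = d \<and> count_list bs c = n - (n - 1) div 2",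
          OF same_knot_trefoil_assigned_diagram[OF that]] sum_bool_pairs
      by (simp add: card_count_list)
  qed
  moreover have "(n - 1) div 2 = n div 2" if "odd n"
    using that by presburger
  ultimately show ?thesis by simp
qed

end
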